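(* Let $f\in x+x^2\mathbb{C}[[x]]$ satisfy $\mathfrak{T}^2f(x)=\dfrac{f(2x)}{2}$. Then there exist $A,k\in\mathbb{C}$ such that $f(x)=\dfrac{\Theta_k(Ax)}{A}$.
   Context: Let $x+x^2\mathbb{C}[[x]]$ denote the set of formal power series with zero constant term and linear coefficient $1$. For $f$ in this set, $\mathfrak{T}f:=f/f'$ (again in $x+x^2\mathbb{C}[[x]]$), $\mathfrak{T}^2=\mathfrak{T}\circ\mathfrak{T}$, and $f^{inv}$ denotes the compositional inverse. For $k\in\mathbb{C}$, $\Theta_k\in x+x^2\mathbb{C}[[x]]$ is defined by $\Theta_k^{inv}(x)=\int_0^x (1-t^2)^{-1/2}(1-k^2t^2)^{-1/2}\,dt$ (integrand expanded as a formal power series). Since the integrand is even, $\Theta_k(x)=\sum_{m\ge0}c_m(k)x^{2m+1}$ is odd, and for $A\in\mathbb{C}$ the expression $\Theta_k(Ax)/A$ denotes the formal series $\sum_{m\ge0}c_m(k)A^{2m}x^{2m+1}$ (which for $A=0$ equals $x$). *)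

theory Defs
  imports Complex_Main "HOL-Computational_Algebra.Formal_Power_Series"
begin

definition tangent_id :: "complex fps set" where
  "tangent_id = {f. fps_nth f 0 = 0 \<and> fps_nth f 1 = 1}"

(* On tangent_id the derivative has constant term 1, so this is division by a unit. *)
definition opT :: "complex fps \<Rightarrow> complex fps" where
  "opT f = f / fps_deriv f"

(* (1 - a t^2)^(-1/2) as a formal power series in t: the binomial series of exponent -1/2,
   evaluated at -a t^2 *)
definition inv_sqrt_factor :: "complex \<Rightarrow> complex fps" where
  "inv_sqrt_factor a = fps_compose (fps_binomial (- 1 / 2)) (- (fps_const a * fps_X ^ 2))"

definition Theta_integral :: "complex \<Rightarrow> complex fps" where
  "Theta_integral k = fps_integral0 (inv_sqrt_factor 1 * inv_sqrt_factor (k ^ 2))"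

definition Theta :: "complex \<Rightarrow> complex fps" where
  "Theta k = fps_inv (Theta_integral k)"

(* Theta_k(A x) / A, that is, the sum of c_m A^(2m) x^(2m+1) where c_m is the coefficient of
   x^(2m+1) in Theta_k; it equals x for A = 0 (by 0 ^ 0 = 1). *)
definition Theta_scaled :: "complex \<Rightarrow> complex \<Rightarrow> complex fps" where
  "Theta_scaled k A = Abs_fps (\<lambda>n. if odd n then fps_nth (Theta k) n * A ^ (n - 1) else 0)"

lemma inv_sqrt_factor_0: "fps_nth (inv_sqrt_factor a) 0 = 1"
  by (simp add: inv_sqrt_factor_def)

lemma inv_sqrt_factor_square:
  "inv_sqrt_factor a ^ 2 = inverse (1 - fps_const a * fps_X ^ 2)"
proof -
  have z: "fps_nth (- (fps_const a * fps_X ^ 2)) 0 = 0" by simp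
  have "fps_binomial (- 1 / 2 :: complex) ^ 2 = inverse (1 + fps_X)"
    using fps_binomial_add_mult[of "- 1 / 2 :: complex" "- 1 / 2"]
    by (simp add: power2_eq_square fps_binomial_minus_one)
  then have "inv_sqrt_factor a ^ 2
      = fps_compose (inverse (1 + fps_X)) (- (fps_const a * fps_X ^ 2))"
    unfolding inv_sqrt_factor_def by (simp only: fps_compose_power[OF z])
  also have "\<dots> = inverse (fps_compose (1 + fps_X) (- (fps_const a * fps_X ^ 2)))"
    by (rule fps_inverse_compose[OF z]) simp
  finally show ?thesis
    by (simp add: fps_compose_add_distrib)
qed

lemma Theta_integral_0: "fps_nth (Theta_integral k) 0 = 0"
  by (simp add: Theta_integral_def)

lemma Theta_integral_1: "fps_nth (Theta_integral k) 1 = 1"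
  by (simp add: Theta_integral_def fps_integral_def inv_sqrt_factor_0)

lemma fps_inv_Theta: "fps_inv (Theta k) = Theta_integral k"
  unfolding Theta_def
  by (rule fps_inv_idempotent) (use Theta_integral_0 Theta_integral_1 in auto)

lemma Theta_in_tangent_id: "Theta k \<in> tangent_id"
  by (simp add: tangent_id_def Theta_def fps_inv_def Theta_integral_1[simplified])

lemma inv_sqrt_factor_even:
  "fps_compose (inv_sqrt_factor a) (- fps_X) = inv_sqrt_factor a"
proof -
  have "fps_compose (fps_const a * fps_X ^ 2) (- fps_X) = fps_const a * fps_X ^ 2"
    by (simp add: fps_compose_mult_distrib power2_eq_square)
  then show ?thesis
    unfolding inv_sqrt_factor_def
    by (subst fps_compose_assoc[symmetric]) (simp_all add: fps_compose_uminus)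
qed

lemma Theta_integral_odd:
  "fps_compose (Theta_integral k) (- fps_X) = - Theta_integral k"
proof -
  let ?h = "inv_sqrt_factor 1 * inv_sqrt_factor (k ^ 2)"
  have "fps_compose ?h (- fps_X) = ?h"
    by (simp add: fps_compose_mult_distrib inv_sqrt_factor_even)
  then have *: "(-1) ^ n * fps_nth ?h n = fps_nth ?h n" for n
    by (metis fps_compose_uminus' fps_nth_Abs_fps)
  show ?thesis
  proof (rule fps_ext)
    fix n
    show "fps_nth (fps_compose (Theta_integral k) (- fps_X)) n = fps_nth (- Theta_integral k) n"
      using *[of "n - 1"]
      by (cases n) (auto simp add: fps_compose_uminus' Theta_integral_def fps_integral_def)
  qed
qed

lemma Theta_odd: "fps_compose (Theta k) (- fps_X) = - Theta k"
proof -
  let ?g = "Theta_integral k" and ?h = "Theta k"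
  have g0: "fps_nth ?g 0 = 0" and g1: "fps_nth ?g 1 \<noteq> 0"
    by (simp_all add: Theta_integral_0 Theta_integral_1[simplified])
  have h0: "fps_nth ?h 0 = 0"
    using Theta_in_tangent_id by (simp add: tangent_id_def)
  have hg: "fps_compose ?h ?g = fps_X"
    unfolding Theta_def by (rule fps_inv[OF g0 g1])
  have gh: "fps_compose ?g ?h = fps_X"
    unfolding Theta_def by (rule fps_inv_right[OF g0 g1])
  have "fps_compose (fps_compose ?h (- fps_X)) ?g = fps_compose ?h (- ?g)"
    by (simp add: fps_compose_assoc[symmetric] g0 fps_compose_uminus)
  also have "\<dots> = fps_compose (fps_compose ?h ?g) (- fps_X)"
    by (simp add: fps_compose_assoc[symmetric] g0 Theta_integral_odd)
  also have "\<dots> = - fps_X"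
    by (simp add: hg)
  finally have "fps_compose (fps_compose (fps_compose ?h (- fps_X)) ?g) ?h = - ?h"
    by (simp add: fps_compose_uminus h0)
  then show ?thesis
    by (simp add: fps_compose_assoc[symmetric] g0 h0 gh)
qed

lemma Theta_nth_even:
  assumes "even n"
  shows "fps_nth (Theta k) n = 0"
proof -
  have "fps_nth (fps_compose (Theta k) (- fps_X)) n = fps_nth (Theta k) n"
    using assms by (simp add: fps_compose_uminus')
  then show ?thesis
    by (simp add: Theta_odd)
qed

lemma Theta_scaled_eq:
  assumes "A \<noteq> 0"
  shows "Theta_scaled k A = fps_const (1 / A) * fps_compose (Theta k) (fps_const A * fps_X)"
proof (rule fps_ext)
  fix n
  show "fps_nth (Theta_scaled k A) n
      = fps_nth (fps_const (1 / A) * fps_compose (Theta k) (fps_const A * fps_X)) n"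
    using assms by (cases n) (simp_all add: Theta_scaled_def Theta_nth_even)
qed

lemma Theta_scaled_0: "Theta_scaled k 0 = fps_X"
  using Theta_in_tangent_id[of k]
  by (intro fps_ext) (auto simp: Theta_scaled_def tangent_id_def power_0_left elim!: oddE)

end

theory Submission
  imports Defs
begin

text \<open>Clearing denominators, the hypothesis becomes the duplication equation
  \<open>f(2x) (f'\<^sup>2 - f f'') = 2 f f'\<close>, whose linearisation at \<open>x\<close> leaves only the coefficients of
  \<open>x\<^sup>3\<close> and \<open>x\<^sup>5\<close> free. The solutions of \<open>y'\<^sup>2 = 1 + a y\<^sup>2 + b y\<^sup>4\<close> satisfy this equation (it is
  the duplication formula of the Jacobi function sn), and \<open>a\<close>, \<open>b\<close> can be chosen to match these two
  coefficients; finally \<open>\<Theta>\<^sub>k(Ax)/A\<close> solves the differential equation as soon as \<open>A\<^sup>2\<close> and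
  \<open>k\<^sup>2A\<^sup>2\<close> are the roots of \<open>z\<^sup>2 + a z + b\<close>.\<close>

section \<open>Clearing denominators in the hypothesis\<close>

definition fps_double :: "complex fps \<Rightarrow> complex fps" where
  "fps_double f = fps_compose f (fps_const 2 * fps_X)"

lemma fps_double_nth [simp]: "fps_nth (fps_double f) n = 2 ^ n * fps_nth f n"
  by (simp add: fps_double_def fps_compose_linear)

lemma opT_mult_deriv:
  assumes "f \<in> tangent_id"
  shows "opT f * fps_deriv f = f"
  using assms by (simp add: opT_def tangent_id_def fps_divide_unit mult.assoc inverse_mult_eq_1)

lemma opT_in_tangent_id:
  assumes "f \<in> tangent_id"
  shows "opT f \<in> tangent_id"
  using assms by (simp add: opT_def tangent_id_def fps_divide_unit fps_mult_nth_1)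

text \<open>Put \<open>g = f / f'\<close>. Differentiating \<open>g f' = f\<close> gives
  \<open>g' f'^2 = f'^2 - f f''\<close>. Since \<open>opT g * g' = g\<close>, multiplying by
  \<open>opT g\<close> leaves \<open>g f'^2 = f f'\<close>.\<close>

lemma opT_opT_mult:
  assumes f: "f \<in> tangent_id"
  shows "opT (opT f) * (fps_deriv f ^ 2 - f * fps_deriv (fps_deriv f)) = f * fps_deriv f"
proof -
  define g where "g = opT f"
  have gf: "g * fps_deriv f = f"
    using f by (simp add: g_def opT_mult_deriv)
  have gg: "opT g * fps_deriv g = g"
    using f by (simp add: g_def opT_mult_deriv opT_in_tangent_id)
  have "fps_deriv (g * fps_deriv f) = fps_deriv f" by (simp only: gf)
  then have dgf: "fps_deriv g * fps_deriv f + g * fps_deriv (fps_deriv f) = fps_deriv f"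
    by (simp add: algebra_simps)
  have "fps_deriv f ^ 2 - f * fps_deriv (fps_deriv f)
      = fps_deriv f * fps_deriv f - (g * fps_deriv f) * fps_deriv (fps_deriv f)"
    by (simp only: gf power2_eq_square)
  also have "\<dots> = (fps_deriv g * fps_deriv f + g * fps_deriv (fps_deriv f)) * fps_deriv f
      - (g * fps_deriv f) * fps_deriv (fps_deriv f)"
    by (simp only: dgf)
  also have "\<dots> = fps_deriv g * fps_deriv f ^ 2"
    by (simp add: algebra_simps power2_eq_square)
  finally show ?thesis
    using gf gg unfolding g_def[symmetric] by algebra
qed

definition duplicates :: "complex fps \<Rightarrow> bool" where
  "duplicates f \<longleftrightarrow>
     fps_double f * (fps_deriv f ^ 2 - f * fps_deriv (fps_deriv f)) = 2 * f * fps_deriv f"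

lemma duplicates_if_opT:
  assumes "f \<in> tangent_id"
    and "opT (opT f) = fps_const (1 / 2) * fps_compose f (fps_const 2 * fps_X)"
  shows "duplicates f"
proof -
  have "2 * opT (opT f) = fps_double f"
    unfolding assms(2) fps_double_def
    by (simp add: fps_numeral_fps_const mult.assoc[symmetric])
  then show ?thesis
    unfolding duplicates_def using opT_opT_mult[OF assms(1)] by (metis mult.assoc)
qed

section \<open>Uniqueness for the duplication equation\<close>

text \<open>Every other term of the Cauchy product has a factor below its bound. Here
  \<open>i\<close> and \<open>j\<close> are only lower bounds for the orders, so the resulting
  coefficient may be zero.\<close>

lemma fps_mult_nth_lowest:
  fixes p q :: "'a::semiring_0 fps"
  assumes "\<And>l. l < i \<Longrightarrow> fps_nth p l = 0" and "\<And>l. l < j \<Longrightarrow> fps_nth q l = 0"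
  shows "fps_nth (p * q) (i + j) = fps_nth p i * fps_nth q j"
proof -
  have "fps_nth (p * q) (i + j) = (\<Sum>l=0..i+j. fps_nth p l * fps_nth q (i + j - l))"
    by (rule fps_mult_nth)
  also have "\<dots> = (\<Sum>l\<in>{i}. fps_nth p l * fps_nth q (i + j - l))"
  proof (rule sum.mono_neutral_right)
    show "\<forall>l\<in>{0..i+j} - {i}. fps_nth p l * fps_nth q (i + j - l) = 0"
    proof
      fix l assume "l \<in> {0..i+j} - {i}"
      then have "l < i \<or> i + j - l < j" by auto
      then show "fps_nth p l * fps_nth q (i + j - l) = 0" using assms by auto
    qed
  qed auto
  finally show ?thesis by simp
qed

text \<open>From 6 on the power dominates, by induction starting at \<open>50 < 64\<close>; the
  cases 2 and 4 are computed. Equality does hold at 3 and 5.\<close>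

lemma two_power_neq:
  assumes "n \<ge> 2" "n \<noteq> 3" "n \<noteq> 5"
  shows "2 ^ n \<noteq> 2 * (int n - 1) ^ 2"
proof -
  have gt: "2 * (int n - 1) ^ 2 < 2 ^ n" if "n \<ge> 6" for n :: nat
    using that
  proof (induction n rule: nat_induct_at_least)
    case (Suc m)
    \<comment> \<open>The inequality \<open>2 m^2 \<le> 4 (m - 1)^2\<close> amounts to
      \<open>(m - 2)^2 \<ge> 2\<close>, which this bound implies.\<close>
    have "4 ^ 2 \<le> (int m - 2) ^ 2" using Suc by (intro power_mono) auto
    then have "2 * (int (Suc m) - 1) ^ 2 \<le> 2 * (2 * (int m - 1) ^ 2)"
      by (simp add: power2_eq_square algebra_simps)
    also have "\<dots> < 2 * 2 ^ m" using Suc by linarith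
    finally show ?case by simp
  qed simp
  consider "n = 2" | "n = 4" | "n \<ge> 6" using assms by linarith
  then show ?thesis using gt[of n] by cases auto
qed

text \<open>Subtracting the two equations and telescoping each product puts a difference of
  corresponding quantities into every term. The letters stand for the series, their derivatives and
  their values at \<open>2x\<close>, treated as independent ring elements.\<close>

lemma duplication_diff:
  fixes f g :: "'a::idom"
  assumes "G * (g1 ^ 2 - g * g2) = 2 * g * g1"
    and "(G + D) * (f1 ^ 2 - f * f2) = 2 * f * f1"
  shows "D * (f1 ^ 2 - f * f2) + G * ((f1 - g1) * (f1 + g1))
    = G * ((f - g) * f2) + G * (g * (f2 - g2)) + 2 * ((f - g) * f1) + 2 * (g * (f1 - g1))"
  using assms by algebra

text \<open>At order \<open>x\<^sup>n\<close> the duplication equation linearises around \<open>x\<close> to the factor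
  \<open>2\<^sup>n - 2 (n - 1)\<^sup>2\<close>, which for \<open>n \<ge> 2\<close> vanishes only at \<open>n = 3\<close> and \<open>n = 5\<close>.\<close>

lemma duplicates_unique:
  assumes f: "f \<in> tangent_id" "duplicates f" and g: "g \<in> tangent_id" "duplicates g"
    and c3: "fps_nth f 3 = fps_nth g 3" and c5: "fps_nth f 5 = fps_nth g 5"
  shows "f = g"
proof (rule ccontr)
  assume "f \<noteq> g"
  define d where "d = f - g"
  define n where "n = subdegree d"
  have dn: "fps_nth d n \<noteq> 0"
    unfolding n_def using \<open>f \<noteq> g\<close> by (intro nth_subdegree_nonzero) (simp add: d_def)
  have low: "fps_nth d l = 0" if "l < n" for l
    using that unfolding n_def by (rule nth_less_subdegree_zero)
  have fn: "fps_nth f 0 = 0" "fps_nth f (Suc 0) = 1" and gn: "fps_nth g 0 = 0" "fps_nth g (Suc 0) = 1"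
    using f g by (simp_all add: tangent_id_def)
  have "fps_nth d 0 = 0" "fps_nth d 1 = 0" "fps_nth d 3 = 0" "fps_nth d 5 = 0"
    using c3 c5 fn gn by (simp_all add: d_def)
  then have "n \<noteq> 0" "n \<noteq> 1" "n \<noteq> 3" "n \<noteq> 5" using dn by metis+
  then have n: "n \<ge> 2" "n \<noteq> 3" "n \<noteq> 5" by auto
  have dbl: "fps_double f = fps_double g + fps_double d"
    by (rule fps_ext) (simp add: d_def algebra_simps)
  have d1: "fps_deriv d = fps_deriv f - fps_deriv g"
    and d2: "fps_deriv (fps_deriv d) = fps_deriv (fps_deriv f) - fps_deriv (fps_deriv g)"
    by (simp_all add: d_def)
  have eq: "fps_double d * (fps_deriv f ^ 2 - f * fps_deriv (fps_deriv f))
      + fps_double g * (fps_deriv d * (fps_deriv f + fps_deriv g))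
      = fps_double g * (d * fps_deriv (fps_deriv f)) + fps_double g * (g * fps_deriv (fps_deriv d))
      + 2 * (d * fps_deriv f) + 2 * (g * fps_deriv d)"
    using duplication_diff[OF g(2)[unfolded duplicates_def] f(2)[unfolded duplicates_def dbl]]
    unfolding d1[symmetric] d2[symmetric] d_def[symmetric] .
  \<comment> \<open>Only lowest-order coefficients enter: \<open>f\<close> and \<open>g\<close>
    start with \<open>x\<close>, \<open>fps_double g\<close> with \<open>2x\<close>, and
    \<open>f'^2 - f f''\<close> has constant term 1, while each derivative of \<open>d\<close>
    lowers its order bound by one.\<close>
  have t1: "fps_nth (fps_double d * (fps_deriv f ^ 2 - f * fps_deriv (fps_deriv f))) n = 2 ^ n * fps_nth d n"
    using fps_mult_nth_lowest[of n "fps_double d" 0 "fps_deriv f ^ 2 - f * fps_deriv (fps_deriv f)"] low fn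
    by (simp add: power2_eq_square)
  have t2a: "fps_nth (fps_deriv d * (fps_deriv f + fps_deriv g)) (n - 1) = 2 * of_nat n * fps_nth d n"
    using fps_mult_nth_lowest[of "n - 1" "fps_deriv d" 0 "fps_deriv f + fps_deriv g"] low fn gn n
    by simp
  have z: "fps_nth (fps_deriv d * h) l = 0" if "l < n - 1" for l h
    using that low by (auto simp: fps_mult_nth intro!: sum.neutral)
  have t2: "fps_nth (fps_double g * (fps_deriv d * (fps_deriv f + fps_deriv g))) n = 4 * of_nat n * fps_nth d n"
    using fps_mult_nth_lowest[of 1 "fps_double g" "n - 1" "fps_deriv d * (fps_deriv f + fps_deriv g)"] z gn n t2a
    by simp
  have t3: "fps_nth (fps_double g * (d * fps_deriv (fps_deriv f))) n = 0"
    using fps_mult_nth_lowest[of 0 "fps_double g" n "d * fps_deriv (fps_deriv f)"] low gn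
    by (simp add: fps_mult_nth)
  have y: "fps_nth (g * fps_deriv (fps_deriv d)) (n - 1) = of_nat n * of_nat (n - 1) * fps_nth d n"
    using fps_mult_nth_lowest[of 1 g "n - 2" "fps_deriv (fps_deriv d)"] low gn n
    by (simp add: Suc_diff_Suc numeral_2_eq_2)
  have y0: "fps_nth (g * fps_deriv (fps_deriv d)) l = 0" if "l < n - 1" for l
    unfolding fps_mult_nth
  proof (rule sum.neutral, intro ballI)
    fix i assume "i \<in> {0..l}"
    then show "fps_nth g i * fps_nth (fps_deriv (fps_deriv d)) (l - i) = 0"
      using that gn low by (cases "i = 0") auto
  qed
  have t4: "fps_nth (fps_double g * (g * fps_deriv (fps_deriv d))) n
      = 2 * of_nat n * of_nat (n - 1) * fps_nth d n"
    using fps_mult_nth_lowest[of 1 "fps_double g" "n - 1" "g * fps_deriv (fps_deriv d)"] y y0 gn n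
    by simp
  have t5: "fps_nth (d * fps_deriv f) n = fps_nth d n"
    using fps_mult_nth_lowest[of n d 0 "fps_deriv f"] low fn by simp
  have t6: "fps_nth (g * fps_deriv d) n = of_nat n * fps_nth d n"
    using fps_mult_nth_lowest[of 1 g "n - 1" "fps_deriv d"] low gn n by simp
  have two: "fps_nth (2 * h) n = 2 * fps_nth h n" for h :: "complex fps"
    by (simp add: fps_numeral_fps_const)
  have "2 ^ n * fps_nth d n + 4 * of_nat n * fps_nth d n
      = 2 * of_nat n * of_nat (n - 1) * fps_nth d n + 2 * fps_nth d n + 2 * (of_nat n * fps_nth d n)"
    using arg_cong[OF eq, of "\<lambda>h. fps_nth h n"] unfolding fps_add_nth two t1 t2 t3 t4 t5 t6 by simp
  then have "(2 ^ n - 2 * (of_nat n - 1) ^ 2) * fps_nth d n = 0"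
    using n by (simp add: of_nat_diff power2_eq_square algebra_simps)
  then have "(2 ^ n - 2 * (of_nat n - 1) ^ 2 :: complex) = 0" using dn by simp
  then have "(of_int (2 ^ n - 2 * (int n - 1) ^ 2) :: complex) = 0" by simp
  then have "2 ^ n - 2 * (int n - 1) ^ 2 = 0" by (simp only: of_int_eq_0_iff)
  then show False using two_power_neq[OF n] by simp
qed

section \<open>The differential equation of Jacobi type\<close>

text \<open>The slope \<open>c\<close> is a parameter so that \<open>y(2x)\<close> is covered as
  well, with \<open>c = 2\<close>. Prescribing it fixes the sign of the square root, which the
  squared equation leaves open.\<close>

definition jacobi_ode :: "complex \<Rightarrow> complex \<Rightarrow> complex \<Rightarrow> complex fps \<Rightarrow> bool" where
  "jacobi_ode c a b y \<longleftrightarrow> fps_nth y 0 = 0 \<and> fps_nth y 1 = c \<and>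
     fps_deriv y ^ 2 = fps_const (c ^ 2) * (1 + fps_const a * y ^ 2 + fps_const b * y ^ 4)"

text \<open>Subtracting the equations shows that \<open>(y - z)' (y' + z')\<close> is a multiple of
  \<open>y - z\<close>. As \<open>y' + z'\<close> has constant term \<open>2c\<close>, which is
  nonzero, the left side has lower order than the right unless \<open>y = z\<close>.\<close>

lemma jacobi_ode_unique:
  assumes c: "c \<noteq> 0" and y: "jacobi_ode c a b y" and z: "jacobi_ode c a b z"
  shows "y = z"
proof (rule ccontr)
  assume "y \<noteq> z"
  define d where "d = y - z"
  define n where "n = subdegree d"
  have dn: "fps_nth d n \<noteq> 0"
    unfolding n_def using \<open>y \<noteq> z\<close> by (intro nth_subdegree_nonzero) (simp add: d_def)
  have low: "fps_nth d l = 0" if "l < n" for l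
    using that unfolding n_def by (rule nth_less_subdegree_zero)
  have "fps_nth d 0 = 0" using y z by (simp add: d_def jacobi_ode_def)
  then have "n \<noteq> 0" using dn by metis
  define r where "r = fps_const (c ^ 2) * (fps_const a * (y + z) + fps_const b * ((y + z) * (y ^ 2 + z ^ 2)))"
  have eq: "fps_deriv d * (fps_deriv y + fps_deriv z) = d * r"
  proof -
    have "fps_deriv d = fps_deriv y - fps_deriv z" by (simp add: d_def)
    then have "fps_deriv d * (fps_deriv y + fps_deriv z) = fps_deriv y ^ 2 - fps_deriv z ^ 2"
      by (simp only: power2_eq_square square_diff_square_factored mult.commute)
    also have "\<dots> = fps_const (c ^ 2) * (1 + fps_const a * y ^ 2 + fps_const b * y ^ 4)
        - fps_const (c ^ 2) * (1 + fps_const a * z ^ 2 + fps_const b * z ^ 4)"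
      using y z by (simp only: jacobi_ode_def)
    also have "\<dots> = d * r" unfolding d_def r_def by algebra
    finally show ?thesis .
  qed
  have "fps_nth (fps_deriv d * (fps_deriv y + fps_deriv z)) (n - 1) = of_nat n * fps_nth d n * (2 * c)"
    using fps_mult_nth_lowest[of "n - 1" "fps_deriv d" 0 "fps_deriv y + fps_deriv z"] low y z \<open>n \<noteq> 0\<close>
    by (simp add: jacobi_ode_def)
  moreover have "fps_nth (d * r) (n - 1) = 0"
    using low \<open>n \<noteq> 0\<close> by (auto simp: fps_mult_nth intro!: sum.neutral)
  ultimately show False using eq c dn \<open>n \<noteq> 0\<close> by simp
qed

text \<open>Differentiate the first-order equation and cancel the nonzero factor
  \<open>2 y'\<close>.\<close>

lemma jacobi_ode_second_order:
  assumes "jacobi_ode 1 a b y"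
  shows "fps_deriv (fps_deriv y) = fps_const a * y + 2 * fps_const b * y ^ 3"
proof -
  have e: "fps_deriv y ^ 2 = 1 + fps_const a * y ^ 2 + fps_const b * y ^ 4"
    using assms by (simp add: jacobi_ode_def)
  have "fps_deriv y * (2 * fps_deriv (fps_deriv y))
      = fps_deriv y * (2 * (fps_const a * y + 2 * fps_const b * y ^ 3))"
    using arg_cong[OF e, of fps_deriv]
    by (simp add: fps_deriv_power' algebra_simps power2_eq_square numeral_eq_Suc)
  moreover have "fps_deriv y \<noteq> 0"
    using assms by (auto simp: jacobi_ode_def fps_eq_iff intro!: exI[of _ 0])
  ultimately show ?thesis by (metis mult_left_cancel zero_neq_numeral)
qed

text \<open>Both \<open>y(2x)\<close> and \<open>2 y y' / (1 - b y\<^sup>4)\<close> solve the equation with initial slope \<open>2\<close>.\<close>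

lemma jacobi_ode_duplicates:
  assumes y: "jacobi_ode 1 a b y"
  shows "duplicates y"
proof -
  define p where "p = fps_const a"
  define q where "q = fps_const b"
  define y1 where "y1 = fps_deriv y"
  define y2 where "y2 = fps_deriv y1"
  \<comment> \<open>The second-order equation gives \<open>y'^2 - y y'' = u\<close>, so the
    duplication equation says precisely that \<open>y(2x) = w\<close>.\<close>
  define u where "u = 1 - q * y ^ 4"
  define w where "w = 2 * y * y1 * inverse u"
  define w1 where "w1 = fps_deriv w"
  have y0: "fps_nth y 0 = 0" and y10: "fps_nth y (Suc 0) = 1" using y by (simp_all add: jacobi_ode_def)
  have e1: "y1 ^ 2 = 1 + p * y ^ 2 + q * y ^ 4"
    using y by (simp add: jacobi_ode_def p_def q_def y1_def)
  have e2: "y2 = p * y + 2 * q * y ^ 3"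
    using jacobi_ode_second_order[OF y] by (simp add: p_def q_def y1_def y2_def)
  have u0: "fps_nth u 0 = 1" using y0 by (simp add: u_def)
  then have "u \<noteq> 0" by auto
  have wu: "w * u = 2 * y * y1"
    using u0 by (simp add: w_def mult.assoc inverse_mult_eq_1)
  have du: "fps_deriv u = - (4 * q * y ^ 3 * y1)"
    by (simp add: u_def q_def y1_def fps_deriv_power' algebra_simps numeral_eq_Suc)
  have "fps_deriv (w * u) = fps_deriv (2 * (y * y1))" by (simp add: wu mult.assoc)
  then have "w1 * u + w * fps_deriv u = 2 * (y1 ^ 2 + y * y2)"
    by (simp add: w1_def y1_def y2_def power2_eq_square algebra_simps)
  then have dwu: "w1 * u - w * (4 * q * y ^ 3 * y1) = 2 * (y1 ^ 2 + y * y2)"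
    by (simp add: du)
  \<comment> \<open>Multiplying by \<open>u^2\<close> removes the inverse, and \<open>e1\<close> and
    \<open>e2\<close> then turn the right side into a polynomial in \<open>y\<close>.\<close>
  have "w1 * u ^ 2 = 2 * (y1 ^ 2 + y * y2) * u + (w * u) * (4 * q * y ^ 3 * y1)"
    unfolding dwu[symmetric] by (simp add: algebra_simps power2_eq_square)
  also have "\<dots> = 2 * (y1 ^ 2 + y * y2) * u + 8 * q * y ^ 4 * y1 ^ 2"
    unfolding wu by (simp add: algebra_simps power2_eq_square numeral_eq_Suc)
  also have "\<dots> = 2 * (1 + 2 * p * y^2 + 6 * q * y^4 + 2 * p * q * y^6 + q^2 * y^8)"
    unfolding e1 e2 u_def by algebra
  finally have w1u: "w1 * u ^ 2 = 2 * (1 + 2 * p * y^2 + 6 * q * y^4 + 2 * p * q * y^6 + q^2 * y^8)" .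
  have "w ^ 2 * u ^ 2 = 4 * y ^ 2 * y1 ^ 2"
    unfolding power_mult_distrib[symmetric] wu by (simp add: power_mult_distrib)
  then have w2u: "w ^ 2 * u ^ 2 = 4 * y ^ 2 * (1 + p * y ^ 2 + q * y ^ 4)"
    by (simp only: e1)
  \<comment> \<open>The equation for \<open>w\<close> is checked after multiplication by
    \<open>u^4\<close>, where both sides are polynomials in \<open>y\<close>; then \<open>u\<close>
    is cancelled.\<close>
  have "w1 ^ 2 * u ^ 4 = (w1 * u ^ 2) ^ 2" by algebra
  also have "\<dots> = 4 * ((u ^ 2) ^ 2 + p * (w ^ 2 * u ^ 2) * u ^ 2 + q * (w ^ 2 * u ^ 2) ^ 2)"
    unfolding w1u w2u unfolding u_def by algebra
  also have "\<dots> = 4 * (1 + p * w ^ 2 + q * w ^ 4) * u ^ 4" by algebra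
  finally have "w1 ^ 2 * u ^ 4 = 4 * (1 + p * w ^ 2 + q * w ^ 4) * u ^ 4" .
  then have "w1 ^ 2 = 4 * (1 + p * w ^ 2 + q * w ^ 4)" using \<open>u \<noteq> 0\<close> by simp
  moreover have "fps_nth w 0 = 0" using y0 by (simp add: w_def)
  moreover have "fps_nth w 1 = 2"
    using arg_cong[OF wu, of "\<lambda>h. fps_nth h 1"] u0 y0 y10 \<open>fps_nth w 0 = 0\<close>
    by (simp add: fps_mult_nth_1 y1_def fps_numeral_fps_const mult.assoc)
  ultimately have w: "jacobi_ode 2 a b w"
    by (simp add: jacobi_ode_def w1_def p_def q_def fps_numeral_fps_const)
  have "fps_deriv (fps_double y) = 2 * fps_double y1"
    by (rule fps_ext) (simp add: fps_numeral_fps_const y1_def algebra_simps)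
  moreover have "fps_double y1 ^ 2 = 1 + p * fps_double y ^ 2 + q * fps_double y ^ 4"
    using arg_cong[OF e1, of fps_double]
    by (simp add: fps_double_def p_def q_def fps_compose_add_distrib fps_compose_mult_distrib fps_compose_power)
  ultimately have "jacobi_ode 2 a b (fps_double y)"
    using y0 y10 by (simp add: jacobi_ode_def p_def q_def power_mult_distrib fps_numeral_fps_const fps_const_power)
  then have "fps_double y = w" by (rule jacobi_ode_unique[OF _ _ w, rotated]) simp
  moreover have "y1 ^ 2 - y * y2 = u" unfolding e1 e2 u_def by algebra
  ultimately show ?thesis
    by (simp add: duplicates_def y1_def[symmetric] y2_def[symmetric] wu)
qed

text \<open>Compare the coefficients of \<open>x\<close> and \<open>x^3\<close> in the second-order
  equation, using \<open>y^3 = x^3 + ...\<close>. Thus the coefficients of \<open>x^3\<close> and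
  \<open>x^5\<close> correspond to \<open>a\<close> and \<open>b\<close>.\<close>

lemma jacobi_ode_coeffs:
  assumes y: "jacobi_ode 1 a b y"
  shows "6 * fps_nth y 3 = a" and "20 * fps_nth y 5 = a * fps_nth y 3 + 2 * b"
proof -
  have y0: "fps_nth y 0 = 0" and y10: "fps_nth y (Suc 0) = 1" using y by (simp_all add: jacobi_ode_def)
  have c: "of_nat (n + 1) * (of_nat (n + 2) * fps_nth y (n + 2)) = a * fps_nth y n + 2 * (b * fps_nth (y ^ 3) n)" for n
    using arg_cong[OF jacobi_ode_second_order[OF y], of "\<lambda>h. fps_nth h n"]
    by (simp add: fps_numeral_fps_const mult.assoc add.commute)
  have "fps_nth (y ^ 3) 1 = 0" "fps_nth (y ^ 3) 3 = 1"
    using y0 y10 by (simp_all add: power3_eq_cube fps_mult_nth numeral_eq_Suc)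
  then show "6 * fps_nth y 3 = a" and "20 * fps_nth y 5 = a * fps_nth y 3 + 2 * b"
    using c[of 1] c[of 3] y10 by (simp_all add: numeral_eq_Suc)
qed

section \<open>Theta and its rescalings as solutions\<close>

text \<open>Let \<open>h\<close> be the integrand. Differentiating the inverse relation gives
  \<open>h(Theta) Theta' = 1\<close>, and \<open>h^2 (1 - x^2)(1 - k^2 x^2) = 1\<close> evaluated at
  \<open>Theta\<close> then yields \<open>Theta'^2\<close>.\<close>

lemma Theta_jacobi_ode: "jacobi_ode 1 (- (1 + k ^ 2)) (k ^ 2) (Theta k)"
proof -
  let ?h = "inv_sqrt_factor 1 * inv_sqrt_factor (k ^ 2)"
  let ?q = "(1 - fps_const 1 * fps_X ^ 2) * (1 - fps_const (k ^ 2) * fps_X ^ 2) :: complex fps"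
  have t0: "fps_nth (Theta k) 0 = 0" and t1: "fps_nth (Theta k) 1 = 1"
    using Theta_in_tangent_id by (simp_all add: tangent_id_def)
  have "fps_compose (Theta_integral k) (Theta k) = fps_X"
    unfolding Theta_def
    by (rule fps_inv_right) (simp_all add: Theta_integral_0 Theta_integral_1[simplified])
  then have "fps_deriv (fps_compose (Theta_integral k) (Theta k)) = 1" by simp
  then have ht: "fps_compose ?h (Theta k) * fps_deriv (Theta k) = 1"
    using fps_compose_deriv[OF t0, of "Theta_integral k"]
    by (simp add: Theta_integral_def fps_deriv_fps_integral)
  have "(inverse u * inverse v) * (u * v) = 1" if "fps_nth u 0 = 1" "fps_nth v 0 = 1" for u v :: "complex fps"
    using that inverse_mult_eq_1[of u] inverse_mult_eq_1[of v] by (simp add: ac_simps)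
  then have "?h ^ 2 * ?q = 1"
    by (simp add: power_mult_distrib inv_sqrt_factor_square)
  then have "fps_compose (?h ^ 2 * ?q) (Theta k) = 1" by (simp only: fps_compose_1)
  then have "1 = fps_compose ?h (Theta k) ^ 2 *
      ((1 - Theta k ^ 2) * (1 - fps_const (k ^ 2) * Theta k ^ 2))"
    by (simp add: fps_compose_mult_distrib[OF t0] fps_compose_power[OF t0, symmetric] fps_compose_sub_distrib power_mult_distrib t0)
  then have "fps_deriv (Theta k) ^ 2 = fps_deriv (Theta k) ^ 2 * (fps_compose ?h (Theta k) ^ 2 *
      ((1 - Theta k ^ 2) * (1 - fps_const (k ^ 2) * Theta k ^ 2)))"
    by (simp only: mult_1_right)
  also have "\<dots> = (fps_compose ?h (Theta k) * fps_deriv (Theta k)) ^ 2 *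
      ((1 - Theta k ^ 2) * (1 - fps_const (k ^ 2) * Theta k ^ 2))"
    by (simp only: power_mult_distrib ac_simps)
  also have "\<dots> = (1 - Theta k ^ 2) * (1 - fps_const (k ^ 2) * Theta k ^ 2)"
    by (simp only: ht power_one mult_1_left)
  also have "\<dots> = 1 + fps_const (- (1 + k ^ 2)) * Theta k ^ 2 + fps_const (k ^ 2) * Theta k ^ 4"
    unfolding fps_const_neg[symmetric] fps_const_add[symmetric] fps_const_1_eq_1 by algebra
  finally show ?thesis using t0 t1 by (simp add: jacobi_ode_def)
qed

lemma Theta_scaled_jacobi_ode:
  "jacobi_ode 1 (- (A ^ 2 + k ^ 2 * A ^ 2)) (k ^ 2 * A ^ 4) (Theta_scaled k A)"
\<comment> \<open>For \<open>A = 0\<close> the series is \<open>x\<close> and both parameters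
  vanish. Otherwise \<open>g' = Theta'(Ax)\<close> and \<open>Theta(Ax) = A g\<close>, so the powers
  of \<open>A\<close> move into the parameters.\<close>
proof (cases "A = 0")
  case True
  then show ?thesis by (simp add: Theta_scaled_0 jacobi_ode_def)
next
  case False
  let ?s = "fps_const A * fps_X :: complex fps"
  let ?g = "Theta_scaled k A" and ?t = "fps_compose (Theta k) (fps_const A * fps_X)"
  have t: "?t = fps_const A * ?g"
    using False by (simp add: Theta_scaled_eq mult.assoc[symmetric])
  have "fps_deriv ?t = fps_compose (fps_deriv (Theta k)) ?s * fps_const A"
    by (subst fps_compose_deriv) simp_all
  then have "fps_const A * fps_deriv ?g = fps_const A * fps_compose (fps_deriv (Theta k)) ?s"
    unfolding t by (simp add: mult.commute)
  then have dg: "fps_deriv ?g = fps_compose (fps_deriv (Theta k)) ?s"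
    using False by simp
  have "fps_deriv (Theta k) ^ 2 = 1 + fps_const (- (1 + k ^ 2)) * Theta k ^ 2 + fps_const (k ^ 2) * Theta k ^ 4"
    using Theta_jacobi_ode[of k] by (simp add: jacobi_ode_def)
  then have "fps_compose (fps_deriv (Theta k) ^ 2) ?s
      = fps_compose (1 + fps_const (- (1 + k ^ 2)) * Theta k ^ 2 + fps_const (k ^ 2) * Theta k ^ 4) ?s"
    by simp
  then have "fps_deriv ?g ^ 2 = 1 + fps_const (- (1 + k ^ 2)) * ?t ^ 2 + fps_const (k ^ 2) * ?t ^ 4"
    unfolding dg
    by (simp add: fps_compose_add_distrib fps_compose_mult_distrib fps_compose_power del: fps_const_neg)
  also have "\<dots> = 1 + fps_const (- (A ^ 2 + k ^ 2 * A ^ 2)) * ?g ^ 2 + fps_const (k ^ 2 * A ^ 4) * ?g ^ 4"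
    unfolding t fps_const_neg[symmetric] fps_const_add[symmetric] fps_const_mult[symmetric]
      fps_const_power[symmetric] fps_const_1_eq_1 by algebra
  finally show ?thesis
    using Theta_in_tangent_id[of k] by (simp add: jacobi_ode_def Theta_scaled_def tangent_id_def)
qed

section \<open>Choice of parameters and conclusion\<close>

lemma exists_Theta_parameters:
  fixes a b :: complex
  shows "\<exists>A k. - (A ^ 2 + k ^ 2 * A ^ 2) = a \<and> k ^ 2 * A ^ 4 = b"
proof -
  define s where "s = csqrt (a ^ 2 - 4 * b)"
  have s: "s ^ 2 = a ^ 2 - 4 * b" by (simp add: s_def)
  \<comment> \<open>The roots \<open>r\<close> and \<open>t\<close> of \<open>z^2 + a z + b\<close>
    are to be \<open>A^2\<close> and \<open>k^2 A^2\<close>. Since \<open>A = 0\<close> makes both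
    zero, a nonzero root, if there is one, has to be taken as \<open>r\<close>.\<close>
  obtain r t where rt: "r + t = - a" "r * t = b" "r = 0 \<Longrightarrow> t = 0"
  proof (cases "s = a")
    case True
    then show ?thesis using s that[of "- a" 0] by simp
  next
    case False
    show ?thesis
      using s False by (intro that[of "(s - a) / 2" "- (s + a) / 2"])
        (auto simp: field_simps power2_eq_square)
  qed
  show ?thesis
  proof (cases "r = 0")
    case True
    then show ?thesis using rt by (intro exI[of _ 0]) auto
  next
    case False
    have "csqrt r ^ 4 = (csqrt r ^ 2) ^ 2"
      by (simp flip: power_mult del: power2_csqrt)
    then have "csqrt (t / r) ^ 2 * csqrt r ^ 4 = t / r * r ^ 2" by simp
    moreover have "- (csqrt r ^ 2 + csqrt (t / r) ^ 2 * csqrt r ^ 2) = - (r + t)"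
      using False by simp
    ultimately show ?thesis
      using rt False by (intro exI[of _ "csqrt r"] exI[of _ "csqrt (t / r)"])
        (auto simp: power2_eq_square add_eq_0_iff2)
  qed
qed

theorem theorem1p2:
  fixes f :: "complex fps"
  assumes "f \<in> tangent_id"
    and "opT (opT f) = fps_const (1 / 2) * fps_compose f (fps_const 2 * fps_X)"
  shows "\<exists>A k :: complex. f = Theta_scaled k A"
proof -
  \<comment> \<open>These values solve the relations of \<open>jacobi_ode_coeffs\<close> for the
    parameters, so that the Theta solution agrees with \<open>f\<close> at \<open>x^3\<close> and
    \<open>x^5\<close>.\<close>
  define a where "a = 6 * fps_nth f 3"
  define b where "b = (20 * fps_nth f 5 - a * fps_nth f 3) / 2"
  obtain A k where Ak: "- (A ^ 2 + k ^ 2 * A ^ 2) = a" "k ^ 2 * A ^ 4 = b"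
    using exists_Theta_parameters by blast
  define g where "g = Theta_scaled k A"
  have g: "jacobi_ode 1 a b g"
    using Theta_scaled_jacobi_ode[of A k] by (simp only: Ak g_def)
  note c = jacobi_ode_coeffs[OF g]
  have "fps_nth f 3 = fps_nth g 3" using c(1) by (simp add: a_def)
  moreover from this have "fps_nth f 5 = fps_nth g 5" using c(2) by (simp add: b_def field_simps)
  moreover have "g \<in> tangent_id" using g by (simp add: jacobi_ode_def tangent_id_def)
  ultimately have "f = g"
    using assms(1) duplicates_if_opT[OF assms] jacobi_ode_duplicates[OF g] duplicates_unique by blast
  then show ?thesis unfolding g_def by blast
qed

end
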